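(* Let $G$ be a finite abelian group, written additively, with exponent $n>1$. For any $a_1,\ldots,a_{n-1}\in G$, there is a permutation $\sigma$ of $\{1,\ldots,n-1\}$ such that all the elements $s\,a_{\sigma(s)}$ $(s=1,\ldots,n-1)$ are nonzero if and only if $$\left|\left\{1\le s<n:\ \tfrac{n}{d}\,a_s\neq 0\right\}\right|\ \ge\ d-1\quad\text{for every positive divisor } d \text{ of } n.$$
   Context: The exponent of a finite group $G$ is the least positive integer $n$ such that $nx=0$ for all $x\in G$. For a positive integer $k$ and $a\in G$, $ka$ denotes the sum of $k$ copies of $a$. *)

theory Defs
  imports "HOL-Algebra.Ring" "HOL-Combinatorics.Permutations"
begin

text \<open>
  Additive groups are the additive parts of HOL-Algebra's ring records, so the multiplicative
  components of \<open>G\<close> play no role here. \<open>[k] \<cdot>\<^bsub>G\<^esub> x\<close> is the sum of \<open>k\<close> copies of \<open>x\<close>.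
  The \<open>LEAST\<close> is meaningful whenever some positive multiple annihilates \<open>G\<close>, which is always
  the case for finite \<open>G\<close>.
\<close>

definition add_exponent :: "('a, 'm) ring_scheme \<Rightarrow> nat" where
  "add_exponent G = (LEAST n::nat. n > 0 \<and> (\<forall>x\<in>carrier G. [n] \<cdot>\<^bsub>G\<^esub> x = \<zero>\<^bsub>G\<^esub>))"

end

theory Submission
  imports Defs "HOL-Algebra.Multiplicative_Group"
begin

text \<open>
  A suitable permutation is a system of distinct representatives of the sets
  \<open>{i. s a\<^sub>i \<noteq> 0}\<close>, \<open>1 \<le> s < n\<close>. For a set \<open>J\<close> of indices \<open>s\<close>, the union of these sets is
  \<open>{i. g a\<^sub>i \<noteq> 0}\<close> with \<open>g = gcd (J \<union> {n})\<close>, because \<open>n\<close> annihilates \<open>G\<close>. As \<open>J\<close> consists of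
  multiples of \<open>g\<close> below \<open>n\<close>, it has at most \<open>n/g - 1\<close> elements, so Hall's condition for \<open>J\<close>
  follows from the hypothesis for \<open>d = n/g\<close>. Conversely, a permutation maps the \<open>d - 1\<close> multiples
  of \<open>n/d\<close> below \<open>n\<close> into \<open>{i. (n/d) a\<^sub>i \<noteq> 0}\<close>.
\<close>

text \<open>
  Rado's proof: if some \<open>A i\<close> contains two elements, one of them can be removed without violating
  Hall's condition. Otherwise the two violating families \<open>S\<close> and \<open>T\<close> contradict the condition for
  \<open>S \<union> T\<close> and \<open>S \<inter> T\<close>.
\<close>

theorem Hall_marriage:
  fixes A :: "'i \<Rightarrow> 'b set"
  assumes "finite I" "\<And>i. i \<in> I \<Longrightarrow> finite (A i)"
    and "\<And>J. J \<subseteq> I \<Longrightarrow> card J \<le> card (\<Union>(A ` J))"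
  shows "\<exists>f. inj_on f I \<and> (\<forall>i\<in>I. f i \<in> A i)"
  using assms(2,3)
proof (induction "\<Sum>i\<in>I. card (A i)" arbitrary: A rule: less_induct)
  case less
  note fin = less.prems(1) and hall = less.prems(2)
  show ?case
  proof (cases "\<forall>i\<in>I. \<forall>x\<in>A i. \<forall>y\<in>A i. x = y")
    case True
    have "\<exists>x. A i = {x}" if "i \<in> I" for i
    proof -
      have "A i \<noteq> {}" using hall[of "{i}"] that by auto
      then show ?thesis using True that by blast
    qed
    then obtain f where f: "\<And>i. i \<in> I \<Longrightarrow> A i = {f i}" by metis
    have "inj_on f I"
    proof (rule inj_onI, rule ccontr)
      fix i j assume ij: "i \<in> I" "j \<in> I" "f i = f j" "i \<noteq> j"
      then have "\<Union>(A ` {i, j}) = {f i}" using f by auto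
      then show False using hall[of "{i, j}"] ij by auto
    qed
    then show ?thesis using f by auto
  next
    case False
    then obtain i x y where i: "i \<in> I" and xy: "x \<in> A i" "y \<in> A i" "x \<noteq> y" by blast
    define B where "B z = A(i := A i - {z})" for z
    have removable: ?thesis if z: "z \<in> A i" and Bz: "\<And>J. J \<subseteq> I \<Longrightarrow> card J \<le> card (\<Union>(B z ` J))" for z
    proof -
      \<comment> \<open>Deleting \<open>z\<close> from \<open>A i\<close> lowers the induction
        measure, and a choice from \<open>B z\<close> is also one from \<open>A\<close>.\<close>
      have "(\<Sum>j\<in>I. card (B z j)) < (\<Sum>j\<in>I. card (A j))"
      proof (rule sum_strict_mono_ex1[OF assms(1)])
        show "\<forall>j\<in>I. card (B z j) \<le> card (A j)"
          using fin by (auto simp: B_def intro: card_mono)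
        show "\<exists>j\<in>I. card (B z j) < card (A j)"
          using i card_Diff1_less[OF fin[OF i] z] by (intro bexI[of _ i]) (simp_all add: B_def)
      qed
      moreover have "finite (B z j)" if "j \<in> I" for j
        using fin that by (auto simp: B_def)
      ultimately obtain f where "inj_on f I" "\<forall>j\<in>I. f j \<in> B z j"
        using less.hyps[of "B z"] Bz by blast
      then show ?thesis by (intro exI[of _ f]) (auto simp: B_def split: if_splits)
    qed
    have violation: "\<exists>S. S \<subseteq> I - {i} \<and> card (\<Union>(A ` S) \<union> (A i - {z})) \<le> card S"
      if z: "z \<in> A i" and contr: "\<not> ?thesis" for z
    proof -
      obtain J where J: "J \<subseteq> I" "card (\<Union>(B z ` J)) < card J"
        using removable[OF z] contr by (meson not_le)
      \<comment> \<open>\<open>B z\<close> and \<open>A\<close> differ only at \<open>i\<close>, so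
        a violating family contains \<open>i\<close>. Removing \<open>i\<close> from it turns the
        strict inequality into the bound by \<open>card S\<close>.\<close>
      have "i \<in> J"
      proof (rule ccontr)
        assume "i \<notin> J"
        then have "\<Union>(B z ` J) = \<Union>(A ` J)" by (auto simp: B_def)
        then show False using J hall[of J] by simp
      qed
      then have "\<Union>(B z ` J) = \<Union>(A ` (J - {i})) \<union> (A i - {z})"
        by (auto simp: B_def split: if_splits)
      moreover have "card J = Suc (card (J - {i}))"
        using \<open>i \<in> J\<close> J(1) assms(1) by (metis card_Suc_Diff1 finite_subset)
      ultimately show ?thesis using J by (intro exI[of _ "J - {i}"]) auto
    qed
    show ?thesis
    proof (rule ccontr)
      assume contr: "\<not> ?thesis"
      obtain S where S: "S \<subseteq> I - {i}" "card (\<Union>(A ` S) \<union> (A i - {x})) \<le> card S"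
        using violation[OF xy(1) contr] by blast
      obtain T where T: "T \<subseteq> I - {i}" "card (\<Union>(A ` T) \<union> (A i - {y})) \<le> card T"
        using violation[OF xy(2) contr] by blast
      let ?X = "\<Union>(A ` S) \<union> (A i - {x})" and ?Y = "\<Union>(A ` T) \<union> (A i - {y})"
      have finST: "finite S" "finite T" using S T assms(1) by (auto intro: finite_subset)
      have finX: "finite ?X" using finST(1) S(1) fin i by auto
      have finY: "finite ?Y" using finST(2) T(1) fin i by auto
      have "card (insert i (S \<union> T)) \<le> card (\<Union>(A ` insert i (S \<union> T)))"
        using S T i by (intro hall) auto
      \<comment> \<open>As \<open>x\<close> and \<open>y\<close> differ, no element of
        \<open>A i\<close> is missing from both \<open>A i - {x}\<close> and
        \<open>A i - {y}\<close>.\<close>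
      moreover have "\<Union>(A ` insert i (S \<union> T)) = ?X \<union> ?Y" using xy(3) by auto
      moreover have "card (insert i (S \<union> T)) = Suc (card (S \<union> T))"
        using finST S T by (subst card_insert_disjoint) auto
      moreover have "card (S \<inter> T) \<le> card (\<Union>(A ` (S \<inter> T)))"
        using S T by (intro hall) auto
      moreover have "card (\<Union>(A ` (S \<inter> T))) \<le> card (?X \<inter> ?Y)"
        using finX by (intro card_mono) auto
      \<comment> \<open>Inclusion-exclusion on both sides: \<open>card ?X + card ?Y\<close> is at
        most \<open>card S + card T\<close>, yet Hall's condition makes it at least one more, the
        extra one coming from \<open>i\<close>.\<close>
      ultimately show False
        using S T card_Un_Int[OF finX finY] card_Un_Int[OF finST] by simp
    qed
  qed
qed

context abelian_group
begin

text \<open>Turns the vanishing of multiples into divisibility by the order, where gcds can be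
  used.\<close>

lemma add_pow_eq_zero_iff_ord_dvd:
  assumes "x \<in> carrier G"
  shows "[k] \<cdot> x = \<zero> \<longleftrightarrow> group.ord (add_monoid G) x dvd (k::nat)"
  using group.pow_eq_id[OF a_group, of x k] assms by (simp add: add_pow_def)

text \<open>By Lagrange the order of the group is a positive annihilator, so the
  \<open>LEAST\<close> is attained.\<close>

lemma add_exponent_annihilates:
  assumes "finite (carrier G)" and "x \<in> carrier G"
  shows "[add_exponent G] \<cdot> x = \<zero>"
proof -
  have "card (carrier G) > 0"
    using assms by (auto simp: card_gt_0_iff)
  moreover have "\<forall>y\<in>carrier G. [card (carrier G)] \<cdot> y = \<zero>"
    using group.pow_order_eq_1[OF a_group] assms(1) by (simp add: add_pow_def order_def)
  ultimately have "\<forall>y\<in>carrier G. [add_exponent G] \<cdot> y = \<zero>"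
    unfolding add_exponent_def
    using LeastI[of "\<lambda>n. n > 0 \<and> (\<forall>y\<in>carrier G. [n] \<cdot> y = \<zero>)" "card (carrier G)"] by blast
  then show ?thesis using assms(2) by blast
qed

end

text \<open>Both 0 and \<open>n\<close> lie outside \<open>J\<close>, so only the multiples
  \<open>k * g\<close> with \<open>1 \<le> k < n div g\<close> remain.\<close>

lemma card_multiples_below_le:
  fixes g n :: nat
  assumes "g dvd n" "n > 0" "J \<subseteq> {1..n - 1}" "\<And>s. s \<in> J \<Longrightarrow> g dvd s"
  shows "card J \<le> n div g - 1"
proof -
  have "g > 0" using assms by (auto intro: Nat.gr0I)
  have "J \<subseteq> (\<lambda>k. k * g) ` {1..<n div g}"
  proof
    fix s assume s: "s \<in> J"
    then obtain k where k: "s = k * g" using assms(4) by (metis dvd_def mult.commute)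
    obtain m where m: "n = m * g" using assms(1) by (metis dvd_def mult.commute)
    have "1 \<le> s" "s < n" using s assms(2,3) by fastforce+
    then have "1 \<le> k" "k < n div g" using k m \<open>g > 0\<close> by (auto intro: Nat.gr0I)
    then show "s \<in> (\<lambda>k. k * g) ` {1..<n div g}" using k by auto
  qed
  then have "card J \<le> card ((\<lambda>k. k * g) ` {1..<n div g})" by (intro card_mono) auto
  also have "\<dots> \<le> n div g - 1" using card_image_le[of "{1..<n div g}"] by simp
  finally show ?thesis .
qed

theorem theorem1p1:
  fixes G :: "('a, 'm) ring_scheme" (structure) and n :: nat and a :: "nat \<Rightarrow> 'a"
  assumes "abelian_group G" and "finite (carrier G)"
    and "n = add_exponent G" and "n > 1"
    and "\<And>s. s \<in> {1..n-1} \<Longrightarrow> a s \<in> carrier G"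
  shows "(\<exists>\<sigma>. \<sigma> permutes {1..n-1} \<and> (\<forall>s\<in>{1..n-1}. [s] \<cdot>\<^bsub>G\<^esub> a (\<sigma> s) \<noteq> \<zero>\<^bsub>G\<^esub>))
     \<longleftrightarrow> (\<forall>d::nat. d > 0 \<and> d dvd n \<longrightarrow>
            card {s. 1 \<le> s \<and> s < n \<and> [(n div d)] \<cdot>\<^bsub>G\<^esub> a s \<noteq> \<zero>\<^bsub>G\<^esub>} \<ge> d - 1)"
    (is "?L \<longleftrightarrow> ?R")
proof -
  interpret abelian_group G by fact
  let ?ord = "group.ord (add_monoid G)"
  note eq_zero_iff = add_pow_eq_zero_iff_ord_dvd[OF assms(5)]
  show ?thesis
  proof
    assume ?L
    then obtain \<sigma> where \<sigma>: "\<sigma> permutes {1..n-1}"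
      and nz: "\<And>s. s \<in> {1..n-1} \<Longrightarrow> [s] \<cdot> a (\<sigma> s) \<noteq> \<zero>" by blast
    show ?R
    proof (intro allI impI, elim conjE)
      fix d :: nat assume d: "d > 0" "d dvd n"
      let ?e = "n div d"
      have n: "n = d * ?e" using d by simp
      then have e: "?e > 0" using assms(4) by (auto intro: Nat.gr0I)
      let ?h = "\<lambda>k. \<sigma> (k * ?e)"
      have "inj_on ?h {1..<d}"
        using e by (intro inj_onI) (auto dest: injD[OF permutes_inj[OF \<sigma>]])
      moreover have "?h ` {1..<d} \<subseteq> {s. 1 \<le> s \<and> s < n \<and> [?e] \<cdot> a s \<noteq> \<zero>}"
      proof
        fix t assume "t \<in> ?h ` {1..<d}"
        then obtain k where k: "1 \<le> k" "k < d" "t = ?h k" by auto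
        have "k * ?e < d * ?e" using k(2) e by simp
        then have mem: "k * ?e \<in> {1..n-1}" using k(1) e n by auto
        then have t: "t \<in> {1..n-1}" using permutes_in_image[OF \<sigma>] k(3) by blast
        \<comment> \<open>If \<open>?e\<close> annihilated \<open>a t\<close>, so would its multiple
          \<open>k * ?e\<close>.\<close>
        have "\<not> ?ord (a t) dvd k * ?e" using nz[OF mem] eq_zero_iff[OF t] k(3) by simp
        then have "\<not> ?ord (a t) dvd ?e" using dvd_mult by blast
        then have "[?e] \<cdot> a t \<noteq> \<zero>" by (simp only: eq_zero_iff[OF t] not_False_eq_True)
        then show "t \<in> {s. 1 \<le> s \<and> s < n \<and> [?e] \<cdot> a s \<noteq> \<zero>}" using t by auto
      qed
      ultimately have "card {1..<d} \<le> card {s. 1 \<le> s \<and> s < n \<and> [?e] \<cdot> a s \<noteq> \<zero>}"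
        by (intro card_inj_on_le) auto
      then show "d - 1 \<le> card {s. 1 \<le> s \<and> s < n \<and> [?e] \<cdot> a s \<noteq> \<zero>}" by simp
    qed
  next
    assume R: ?R
    let ?A = "\<lambda>s. {i \<in> {1..n-1}. [s] \<cdot> a i \<noteq> \<zero>}"
    have "\<exists>f. inj_on f {1..n-1} \<and> (\<forall>s\<in>{1..n-1}. f s \<in> ?A s)"
    proof (rule Hall_marriage)
      fix J assume J: "J \<subseteq> {1..n-1}"
      \<comment> \<open>Including \<open>n\<close> makes \<open>g\<close> a divisor of
        \<open>n\<close>, so that \<open>n div g\<close> can serve as \<open>d\<close>; for empty
        \<open>J\<close> it gives \<open>g = n\<close>.\<close>
      define g where "g = Gcd (insert n J)"
      have gn: "g dvd n" and gJ: "\<And>s. s \<in> J \<Longrightarrow> g dvd s"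
        unfolding g_def by (blast intro: Gcd_dvd)+
      have ng: "n div g > 0" "n div (n div g) = g" "n div g dvd n"
        using gn assms(4) by (auto elim!: dvdE intro!: Nat.gr0I split: if_splits)
      have "card J \<le> n div g - 1"
        using card_multiples_below_le[OF gn _ J] gJ assms(4) by simp
      also have "\<dots> \<le> card {i. 1 \<le> i \<and> i < n \<and> [g] \<cdot> a i \<noteq> \<zero>}"
        using R[rule_format, of "n div g"] ng by simp
      also have "\<dots> \<le> card (\<Union>(?A ` J))"
      proof (rule card_mono)
        show "finite (\<Union>(?A ` J))"
          using finite_subset[OF J] by auto
        show "{i. 1 \<le> i \<and> i < n \<and> [g] \<cdot> a i \<noteq> \<zero>} \<subseteq> \<Union>(?A ` J)"
        proof
          fix i assume "i \<in> {i. 1 \<le> i \<and> i < n \<and> [g] \<cdot> a i \<noteq> \<zero>}"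
          then have i: "i \<in> {1..n-1}" and nz: "[g] \<cdot> a i \<noteq> \<zero>" by auto
          have "?ord (a i) dvd n"
            using add_exponent_annihilates[OF assms(2) assms(5)[OF i]] eq_zero_iff[OF i] assms(3)
            by simp
          \<comment> \<open>The order divides \<open>n\<close> but not \<open>g\<close>, so some
            other argument of the gcd, an element of \<open>J\<close>, is not divisible by
            it.\<close>
          moreover have "\<not> ?ord (a i) dvd g" using nz eq_zero_iff[OF i] by simp
          ultimately obtain s where "s \<in> J" "\<not> ?ord (a i) dvd s"
            unfolding g_def by (metis Gcd_greatest insertE)
          then have "i \<in> ?A s" using i by (simp only: eq_zero_iff[OF i] mem_Collect_eq simp_thms)
          then show "i \<in> \<Union>(?A ` J)" using \<open>s \<in> J\<close> by blast
        qed
      qed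
      finally show "card J \<le> card (\<Union>(?A ` J))" .
    qed auto
    then obtain f where f: "inj_on f {1..n-1}" "\<And>s. s \<in> {1..n-1} \<Longrightarrow> f s \<in> ?A s" by blast
    \<comment> \<open>An injection of a finite set into itself is onto; the identity outside makes
      it a permutation.\<close>
    define \<sigma> where "\<sigma> s = (if s \<in> {1..n-1} then f s else s)" for s
    have "f ` {1..n-1} = {1..n-1}"
      using f by (intro card_subset_eq) (auto simp: card_image)
    then have "bij_betw \<sigma> {1..n-1} {1..n-1}"
      using f(1) by (simp add: bij_betw_def \<sigma>_def inj_on_def)
    then have "\<sigma> permutes {1..n-1}"
      by (rule bij_imp_permutes) (auto simp: \<sigma>_def)
    moreover have "[s] \<cdot> a (\<sigma> s) \<noteq> \<zero>" if "s \<in> {1..n-1}" for s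
      using f(2)[OF that] that by (auto simp: \<sigma>_def)
    ultimately show ?L by blast
  qed
qed

end
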